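(* Let $P$ be a finite set of points in general position in the plane with $|P|\ge 5$, and let $T$ be a vertex of $G(P)$. Define the graph $D_T$ as follows: its vertices are the distinct sets among $U(T,S)$ and $I(T,S)$, where $S$ ranges over the neighbors of $T$ in $G(P)$; two such sets are adjacent in $D_T$ iff their intersection consists of exactly two vertices of $G(P)$ (i.e., a single edge of $G(P)$). Then $D_T$ is connected.
   Context: General position means no three points are collinear. $K(P)$ is the complete geometric graph on $P$ with straight-segment edges; two segments with four distinct endpoints cross if they intersect. An SST is a spanning tree of $K(P)$ no two of whose edges cross; spanning subgraphs are identified with their edge sets. $G(P)$ is the abstract graph whose vertices are the SSTs of $K(P)$, two SSTs $A,B$ being adjacent iff $|A\triangle B|=2$. For adjacent vertices $A,B$ of $G(P)$: $U(A,B)=\{C\in V(G(P)): C\subseteq A\cup B\}$ (a U-clique) and $I(A,B)=\{C\in V(G(P)): C\supseteq A\cap B\}$ (an I-clique); these are cliques of $G(P)$ containing $A$ and $B$ (possibly equal to $\{A,B\}$, in which case they are called degenerate). *)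

theory Defs
  imports "HOL-Analysis.Analysis" "Graph_Theory.Digraph_Component"
begin

definition general_position :: "(real ^ 2) set \<Rightarrow> bool" where
  "general_position P \<longleftrightarrow>
     (\<forall>a\<in>P. \<forall>b\<in>P. \<forall>c\<in>P. distinct [a, b, c] \<longrightarrow> \<not> collinear {a, b, c})"

text \<open>Edges are two-element sets of points, each standing for the straight segment
  between its endpoints. Subgraphs of the complete geometric graph that span its
  vertex set are identified with their edge sets.\<close>

definition complete_edges :: "'a set \<Rightarrow> 'a set set" where
  "complete_edges P = {{a, b} | a b. a \<in> P \<and> b \<in> P \<and> a \<noteq> b}"

definition edges_cross :: "(real ^ 2) set \<Rightarrow> (real ^ 2) set \<Rightarrow> bool" where
  "edges_cross e f \<longleftrightarrow>
     (\<exists>a b c d. e = {a, b} \<and> f = {c, d} \<and> distinct [a, b, c, d] \<and>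
        closed_segment a b \<inter> closed_segment c d \<noteq> {})"

text \<open>Following \<^theory>\<open>Graph_Theory.Digraph\<close>, undirected graphs are rendered as
  symmetric digraphs: the edge \<open>{a, b}\<close> becomes the two arcs \<open>(a, b)\<close> and \<open>(b, a)\<close>.\<close>

definition spanning_graph :: "'a set \<Rightarrow> 'a set set \<Rightarrow> 'a pair_pre_digraph" where
  "spanning_graph P F = \<lparr> pverts = P, parcs = {(a, b). a \<noteq> b \<and> {a, b} \<in> F} \<rparr>"

text \<open>In a symmetric digraph each edge gives a directed cycle of length 2, so the library's
  \<^const>\<open>forest\<close> and \<^const>\<open>spanning_tree\<close> are not the undirected notions. The cycles of
  the undirected graph are the directed cycles of length at least 3.\<close>

definition spanning_tree_edges :: "'a set \<Rightarrow> 'a set set \<Rightarrow> bool" where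
  "spanning_tree_edges P F \<longleftrightarrow>
     F \<subseteq> complete_edges P \<and>
     Digraph_Component.connected (with_proj (spanning_graph P F)) \<and>
     \<not> (\<exists>p. pre_digraph.cycle (with_proj (spanning_graph P F)) p \<and> 3 \<le> length p)"

definition is_SST :: "(real ^ 2) set \<Rightarrow> (real ^ 2) set set \<Rightarrow> bool" where
  "is_SST P F \<longleftrightarrow>
     spanning_tree_edges P F \<and> (\<forall>e\<in>F. \<forall>f\<in>F. \<not> edges_cross e f)"

definition SST_graph :: "(real ^ 2) set \<Rightarrow> (real ^ 2) set set pair_pre_digraph" where
  "SST_graph P =
     \<lparr> pverts = {F. is_SST P F},
       parcs = {(A, B). is_SST P A \<and> is_SST P B \<and> card (sym_diff A B) = 2} \<rparr>"

definition U_clique ::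
  "(real ^ 2) set \<Rightarrow> (real ^ 2) set set \<Rightarrow> (real ^ 2) set set \<Rightarrow> (real ^ 2) set set set" where
  "U_clique P A B = {C \<in> pverts (SST_graph P). C \<subseteq> A \<union> B}"

definition I_clique ::
  "(real ^ 2) set \<Rightarrow> (real ^ 2) set set \<Rightarrow> (real ^ 2) set set \<Rightarrow> (real ^ 2) set set set" where
  "I_clique P A B = {C \<in> pverts (SST_graph P). A \<inter> B \<subseteq> C}"

definition cliques_at ::
  "(real ^ 2) set \<Rightarrow> (real ^ 2) set set \<Rightarrow> (real ^ 2) set set set set" where
  "cliques_at P T =
     {U_clique P T S | S. (T, S) \<in> parcs (SST_graph P)} \<union>
     {I_clique P T S | S. (T, S) \<in> parcs (SST_graph P)}"

text \<open>A degenerate clique meets itself in exactly two elements; the condition \<open>X \<noteq> Y\<close>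
  keeps the graph loop-free.\<close>

definition clique_graph ::
  "(real ^ 2) set \<Rightarrow> (real ^ 2) set set \<Rightarrow> (real ^ 2) set set set pair_pre_digraph" where
  "clique_graph P T =
     \<lparr> pverts = cliques_at P T,
       parcs = {(X, Y). X \<in> cliques_at P T \<and> Y \<in> cliques_at P T \<and> X \<noteq> Y \<and>
                        card (X \<inter> Y) = 2} \<rparr>"

end

theory Submission
  imports Defs
begin

text \<open>
  Let \<open>f\<close> be an edge outside \<open>T\<close> and \<open>e\<close> an edge of \<open>T\<close> such that \<open>T - e + f\<close> is an SST. A U-clique
  at \<open>T\<close> depends only on \<open>f\<close>, an I-clique only on \<open>e\<close>, and the two cliques of the pair are equal
  or meet in exactly \<open>T\<close> and \<open>T - e + f\<close>. Hence it suffices to connect any two edges of \<open>T\<close> by a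
  chain in which consecutive edges can be exchanged for a common \<open>f\<close>, and since \<open>T\<close> is connected
  one may take two edges at a common vertex \<open>b\<close>.

  Suppose the chain-connectivity classes of the edges at \<open>b\<close> split the branches of \<open>T\<close> at \<open>b\<close> into
  two nonempty parts \<open>X\<close> and \<open>Y\<close>. Choose neighbours \<open>a \<in> X\<close> and \<open>c \<in> Y\<close> of \<open>b\<close> with no neighbour
  of \<open>b\<close> inside the angle \<open>abc\<close>. Some line supporting the points of \<open>P - b\<close> in this angle from
  the side of \<open>b\<close> touches points \<open>p \<in> X\<close> and \<open>q \<in> Y\<close>. An edge of \<open>T\<close> crossing \<open>pq\<close> would have to
  end at \<open>b\<close> or to cross \<open>ab\<close> or \<open>bc\<close>, so \<open>pq\<close> crosses no edge of \<open>T\<close>; it can replace the edge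
  from \<open>b\<close> to the branch of \<open>p\<close> as well as the edge from \<open>b\<close> to the branch of \<open>q\<close>, a contradiction.
\<close>

subsection \<open>Trees as connected graphs in which every edge is a bridge\<close>

definition edge_rel :: "'a set set \<Rightarrow> ('a \<times> 'a) set" where
  "edge_rel F = {(a, b). a \<noteq> b \<and> {a, b} \<in> F}"

abbreviation joined :: "'a set set \<Rightarrow> 'a \<Rightarrow> 'a \<Rightarrow> bool" where
  "joined F u v \<equiv> (u, v) \<in> (edge_rel F)\<^sup>*"

lemma sym_edge_rel: "sym (edge_rel F)"
  by (auto simp: edge_rel_def sym_def insert_commute)

lemma joined_sym: "joined F u v \<Longrightarrow> joined F v u"
  using sym_rtrancl[OF sym_edge_rel] by (meson symD)

lemma joined_mono: "joined F u v \<Longrightarrow> F \<subseteq> G \<Longrightarrow> joined G u v"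
  by (erule rtrancl_mono[THEN subsetD, rotated]) (auto simp: edge_rel_def)

lemma joined_trans: "joined F u v \<Longrightarrow> joined F v w \<Longrightarrow> joined F u w"
  by (rule rtrancl_trans)

lemma joined_edge: "u \<noteq> v \<Longrightarrow> {u, v} \<in> F \<Longrightarrow> joined F u v"
  by (auto simp: edge_rel_def)

text \<open>A walk need use the new edge at most once; the disjuncts record whether and in which
  direction it does. The induction shortcuts repeated uses.\<close>

lemma joined_insert:
  assumes "joined (insert {p, q} F) u v"
  shows "joined F u v \<or> joined F u p \<and> joined F q v \<or> joined F u q \<and> joined F p v"
  using assms
proof (induction rule: rtrancl_induct)
  case base
  then show ?case by simp
next
  case (step y z)
  then consider "(y, z) \<in> edge_rel F" | "y = p" "z = q" | "y = q" "z = p"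
    by (auto simp: edge_rel_def doubleton_eq_iff)
  then show ?case
    using step.IH by cases (auto intro: rtrancl_into_rtrancl)
qed

text \<open>Replaces the library's connectivity, which goes through the symmetric closure and
  reachability restricted to the vertex set, by a plain closure: with symmetric arcs inside
  \<open>V\<close>, a walk starting in \<open>V\<close> never leaves it.\<close>

lemma connected_with_proj_iff:
  assumes "sym R" and "R \<subseteq> V \<times> V"
  shows "Digraph_Component.connected (with_proj \<lparr>pverts = V, parcs = R\<rparr>) \<longleftrightarrow>
    V \<noteq> {} \<and> (\<forall>u\<in>V. \<forall>v\<in>V. (u, v) \<in> R\<^sup>*)"
proof -
  have "R\<^sup>s = R"
    using assms(1) by (auto simp: symcl_def sym_conv_converse_eq)
  moreover have "(u, v) \<in> rtrancl_on V R \<longleftrightarrow> (u, v) \<in> R\<^sup>*" if "u \<in> V" for u v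
  proof
    show "(u, v) \<in> R\<^sup>*" if "(u, v) \<in> rtrancl_on V R"
      using that by (induction rule: rtrancl_on_induct) (auto intro: rtrancl_into_rtrancl)
    show "(u, v) \<in> rtrancl_on V R" if "(u, v) \<in> R\<^sup>*"
      using that
      by (induction rule: rtrancl_induct)
        (use \<open>u \<in> V\<close> assms(2) in \<open>auto intro: rtrancl_on_into_rtrancl_on\<close>)
  qed
  ultimately show ?thesis
    by (auto simp: connected_conv)
qed

text \<open>Acyclicity in the form that every edge is a bridge, so that exchange arguments need only
  reachability and no lists of arcs. Nonemptiness of \<open>P\<close> mirrors the library's
  connectivity.\<close>

definition bridge_tree :: "'a set \<Rightarrow> 'a set set \<Rightarrow> bool" where
  "bridge_tree P F \<longleftrightarrow> F \<subseteq> complete_edges P \<and> P \<noteq> {} \<and> (\<forall>u\<in>P. \<forall>v\<in>P. joined F u v) \<and>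
     (\<forall>u v. u \<noteq> v \<longrightarrow> {u, v} \<in> F \<longrightarrow> \<not> joined (F - {{u, v}}) u v)"

section \<open>Cycles versus bridges\<close>

lemma in_complete_edges_iff [simp]: "{u, v} \<in> complete_edges P \<longleftrightarrow> u \<in> P \<and> v \<in> P \<and> u \<noteq> v"
  by (auto simp: complete_edges_def doubleton_eq_iff)

lemma edge_rel_subset: "F \<subseteq> complete_edges P \<Longrightarrow> edge_rel F \<subseteq> P \<times> P"
  using in_complete_edges_iff by (fastforce simp: edge_rel_def)

lemma spanning_graph_eq: "spanning_graph P F = \<lparr>pverts = P, parcs = edge_rel F\<rparr>"
  by (simp add: spanning_graph_def edge_rel_def)

lemma spanning_graph_simps [simp]:
  "pverts (spanning_graph P F) = P" "parcs (spanning_graph P F) = edge_rel F"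
  by (simp_all add: spanning_graph_eq)

lemma pair_wf_spanning_graph:
  "F \<subseteq> complete_edges P \<Longrightarrow> pair_wf_digraph (spanning_graph P F)"
  using edge_rel_subset[of F P] by unfold_locales auto

text \<open>A cycle without one of its edges still joins the ends of that edge; conversely, a path
  avoiding an edge between its ends closes up to a cycle. The bound \<open>3\<close> rules out going
  back and forth along one edge.\<close>

lemma exists_cycle_iff:
  assumes F: "F \<subseteq> complete_edges P"
  shows "(\<exists>p. pre_digraph.cycle (with_proj (spanning_graph P F)) p \<and> 3 \<le> length p) \<longleftrightarrow>
    (\<exists>u v. u \<noteq> v \<and> {u, v} \<in> F \<and> joined (F - {{u, v}}) u v)"
proof
  assume "\<exists>p. pre_digraph.cycle (with_proj (spanning_graph P F)) p \<and> 3 \<le> length p"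
  interpret G: pair_wf_digraph "spanning_graph P F"
    using F by (rule pair_wf_spanning_graph)
  obtain p u where p: "G.awalk u p u" "distinct (tl (pawalk_verts u p))" "3 \<le> length p"
    using \<open>\<exists>p. _\<close> by (auto simp: G.cycle_def)
  obtain a b c q where q: "p = a # b # c # q"
    using p(3) by (auto simp: numeral_3_eq_3 Suc_le_length_iff)
  obtain v w where ab: "a = (u, v)" "b = (v, w)"
    using p(1) q by (cases a; cases b) (auto simp: G.awalk_def)
  have cq: "pcas w (c # q) u" "set (c # q) \<subseteq> edge_rel F" "v \<notin> set (pawalk_verts w (c # q))"
    and dist: "distinct (pawalk_verts w (c # q))"
    and uv: "(u, v) \<in> edge_rel F" and vw: "(v, w) \<in> edge_rel F"
    using p ab q by (auto simp: G.awalk_def)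
  have last: "u \<in> set (pawalk_verts x r)" if "pcas x r u" for x r
    using that by (induction r arbitrary: x) auto
  \<comment> \<open>The closing vertex \<open>u\<close> is reached after traversing
    \<open>c\<close>, so \<open>w = u\<close> would repeat a vertex. Here the length bound
    enters.\<close>
  have "w \<noteq> u"
    using cq(1) dist last by auto
  \<comment> \<open>A walk that avoids \<open>v\<close> never uses the edge
    \<open>{u, v}\<close>.\<close>
  have "joined (F - {{u, v}}) x y" if "pcas x r y" "set r \<subseteq> edge_rel F" "v \<notin> set (pawalk_verts x r)" for x r y
    using that
  proof (induction r arbitrary: x)
    case Nil
    then show ?case by simp
  next
    case (Cons e r)
    obtain z where e: "e = (x, z)"
      using Cons.prems by (cases e) auto
    have "(x, z) \<in> edge_rel (F - {{u, v}})"
      using Cons.prems e by (cases r) (auto simp: edge_rel_def doubleton_eq_iff)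
    moreover have "joined (F - {{u, v}}) z y"
      using Cons e by auto
    ultimately show ?case
      by (rule converse_rtrancl_into_rtrancl)
  qed
  from this[OF cq] have "joined (F - {{u, v}}) w u" .
  moreover have "joined (F - {{u, v}}) v w"
    using vw \<open>w \<noteq> u\<close> by (auto simp: edge_rel_def doubleton_eq_iff)
  ultimately have "joined (F - {{u, v}}) u v"
    by (meson joined_sym joined_trans)
  moreover have "u \<noteq> v" "{u, v} \<in> F"
    using uv by (simp_all add: edge_rel_def)
  ultimately show "\<exists>u v. u \<noteq> v \<and> {u, v} \<in> F \<and> joined (F - {{u, v}}) u v"
    by blast
next
  assume "\<exists>u v. u \<noteq> v \<and> {u, v} \<in> F \<and> joined (F - {{u, v}}) u v"
  then obtain u v where uv: "u \<noteq> v" "{u, v} \<in> F" "joined (F - {{u, v}}) u v"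
    by blast
  define H where "H = spanning_graph P (F - {{u, v}})"
  interpret G: pair_wf_digraph "spanning_graph P F"
    using F by (rule pair_wf_spanning_graph)
  interpret H: pair_wf_digraph H
    unfolding H_def using F by (intro pair_wf_spanning_graph) auto
  have uP: "u \<in> P" "v \<in> P"
    using F uv(1,2) by auto
  have "reachable (with_proj H) u v"
    using uv(3)
  proof (induction rule: rtrancl_induct)
    case base
    then show ?case using H.reachable_refl[of u] uP by (simp add: H_def)
  next
    case (step y z)
    then show ?case
      using H.reachable_adj_trans[of u y z] by (simp add: H_def)
  qed
  then obtain p where p: "H.apath u p v"
    using H.reachable_awalk H.apath_awalk_to_apath by blast
  have pw: "pcas u p v" "set p \<subseteq> edge_rel (F - {{u, v}})" "distinct (pawalk_verts u p)"
    using p unfolding H.apath_def H.awalk_def by (simp_all add: H_def)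
  \<comment> \<open>An empty path would give \<open>u = v\<close>, and a single arc would be the
    deleted edge; so closing the path by \<open>(v, u)\<close> yields at least three arcs.\<close>
  have "p \<noteq> []" "\<And>a. p \<noteq> [a]"
    using pw uv(1) by (auto simp: edge_rel_def)
  then have len: "2 \<le> length p"
    by (metis One_nat_def Suc_1 Suc_leI length_0_conv length_Suc_conv less_one linorder_not_less nat_less_le)
  have "G.cycle ((v, u) # p)"
    unfolding G.cycle_def
    using pw uv uP by (auto simp: G.awalk_def edge_rel_def insert_commute)
  with len show "\<exists>p. pre_digraph.cycle (with_proj (spanning_graph P F)) p \<and> 3 \<le> length p"
    by (intro exI[of _ "(v, u) # p"]) auto
qed

lemma spanning_tree_edges_iff: "spanning_tree_edges P F \<longleftrightarrow> bridge_tree P F"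
proof (cases "F \<subseteq> complete_edges P")
  case True
  then show ?thesis
    unfolding spanning_tree_edges_def bridge_tree_def exists_cycle_iff[OF True]
    using connected_with_proj_iff[OF sym_edge_rel edge_rel_subset[OF True]]
    by (auto simp: spanning_graph_eq)
qed (auto simp: spanning_tree_edges_def bridge_tree_def)

text \<open>Deleting \<open>{x, y}\<close> separates the tree into the sides of \<open>x\<close> and
  \<open>y\<close>; an edge from one side to the other reunites them without closing a
  cycle.\<close>

lemma bridge_tree_exchange:
  assumes T: "bridge_tree P T" and e: "{x, y} \<in> T" "x \<noteq> y"
    and p: "joined (T - {{x, y}}) x p" and q: "joined (T - {{x, y}}) y q"
    and pq: "p \<in> P" "q \<in> P" "p \<noteq> q"
  shows "bridge_tree P (insert {p, q} (T - {{x, y}}))" (is "bridge_tree P ?S")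
  unfolding bridge_tree_def
proof (intro conjI allI impI ballI)
  let ?R = "T - {{x, y}}"
  have nb: "\<And>u v. u \<noteq> v \<Longrightarrow> {u, v} \<in> T \<Longrightarrow> \<not> joined (T - {{u, v}}) u v"
    and conn: "\<And>u v. u \<in> P \<Longrightarrow> v \<in> P \<Longrightarrow> joined T u v"
    using T by (auto simp: bridge_tree_def)
  have npq: "\<not> joined ?R p q"
    using nb[OF e(2,1)] p q by (meson joined_sym joined_trans)
  show "?S \<subseteq> complete_edges P" "P \<noteq> {}"
    using T pq by (auto simp: bridge_tree_def)
  have xy: "joined ?S x y"
  proof -
    have "joined ?S x p" "joined ?S q y"
      using p q by (auto intro: joined_mono joined_sym)
    then show ?thesis
      using pq(3) joined_edge[of p q ?S] by (meson insertI1 joined_trans)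
  qed
  show "joined ?S u v" if "u \<in> P" "v \<in> P" for u v
  proof -
    have "joined (insert {x, y} ?R) u v"
      using conn[OF that] e(1) by (simp add: insert_absorb)
    from joined_insert[OF this] show ?thesis
      using xy joined_sym[OF xy] joined_mono[where F = ?R and G = ?S] by (meson joined_trans subset_insertI)
  qed
  show "\<not> joined (?S - {{u, v}}) u v" if "u \<noteq> v" "{u, v} \<in> ?S" for u v
  proof (cases "{u, v} = {p, q}")
    case True
    then have "?S - {{u, v}} \<subseteq> ?R" by auto
    then show ?thesis
      using True npq by (auto simp: doubleton_eq_iff dest: joined_mono joined_sym)
  next
    case False
    then have uv: "{u, v} \<in> T" "{u, v} \<in> ?R"
      using that by auto
    have "?S - {{u, v}} = insert {p, q} (?R - {{u, v}})"
      using False by auto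
    moreover have "\<not> joined (?R - {{u, v}}) u v"
      using nb[OF that(1) uv(1)] joined_mono[of u v "?R - {{u, v}}" "T - {{u, v}}"] by auto
    \<comment> \<open>The ends of an old edge lie on the same side, so a detour between them through
      the new edge would join \<open>p\<close> to \<open>q\<close> already in
      \<open>?R\<close>.\<close>
    moreover have "joined ?R u v"
      using joined_edge[OF that(1) uv(2)] .
    then have "\<not> (joined ?R u p \<and> joined ?R q v)" "\<not> (joined ?R u q \<and> joined ?R p v)"
      using npq by (meson joined_sym joined_trans)+
    ultimately show ?thesis
      using joined_insert[where F = "?R - {{u, v}}" and u = u and v = v and p = p and q = q] joined_mono[where F = "?R - {{u, v}}" and G = ?R]
      by (metis Diff_subset)
  qed
qed

text \<open>Trees are minimal among connected spanning graphs: an edge of \<open>T\<close> missing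
  from \<open>S\<close> is bypassed by a walk in \<open>S\<close> and hence is no bridge of
  \<open>T\<close>.\<close>

lemma bridge_tree_subset_eq:
  assumes "bridge_tree P S" "bridge_tree P T" "S \<subseteq> T"
  shows "S = T"
proof (rule ccontr)
  assume "S \<noteq> T"
  then obtain f where f: "f \<in> T" "f \<notin> S"
    using assms(3) by auto
  moreover have "T \<subseteq> complete_edges P"
    using assms(2) by (simp add: bridge_tree_def)
  ultimately obtain u v where uv: "f = {u, v}" "u \<in> P" "v \<in> P" "u \<noteq> v"
    unfolding complete_edges_def by blast
  have "joined S u v"
    using assms(1) uv by (auto simp: bridge_tree_def)
  then have "joined (T - {{u, v}}) u v"
    by (rule joined_mono) (use f uv assms(3) in auto)
  then show False
    using assms(2) f uv by (auto simp: bridge_tree_def)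
qed

text \<open>By minimality neither tree contains the other, so of the two differing edges one lies on
  each side.\<close>

lemma bridge_tree_sym_diff:
  assumes "bridge_tree P S" "bridge_tree P T" "card (sym_diff T S) = 2"
  obtains e f where "e \<in> T" "f \<notin> T" "S = insert f (T - {e})"
proof -
  have "\<not> S \<subseteq> T" "\<not> T \<subseteq> S"
    using assms bridge_tree_subset_eq by fastforce+
  then obtain e f where ef: "e \<in> T" "e \<notin> S" "f \<in> S" "f \<notin> T"
    by auto
  have "finite (sym_diff T S)"
    using assms(3) by (metis card.infinite zero_neq_numeral)
  then have "sym_diff T S = {e, f}"
    using ef assms(3) by (intro card_seteq[symmetric]) (auto simp: card_insert_if)
  then have "S = insert f (T - {e})"
    using ef by blast
  with ef that show ?thesis by blast
qed

subsection \<open>Exchanges and cliques\<close>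

lemma SST_graph_simps:
  "pverts (SST_graph P) = {F. is_SST P F}"
  "parcs (SST_graph P) = {(A, B). is_SST P A \<and> is_SST P B \<and> card (sym_diff A B) = 2}"
  by (simp_all add: SST_graph_def)

lemma is_SST_bridge_tree: "is_SST P F \<Longrightarrow> bridge_tree P F"
  by (simp add: is_SST_def spanning_tree_edges_iff)

definition exchange :: "(real ^ 2) set \<Rightarrow> (real ^ 2) set set \<Rightarrow> (real ^ 2) set \<Rightarrow> (real ^ 2) set \<Rightarrow> bool" where
  "exchange P T e f \<longleftrightarrow> e \<in> T \<and> f \<notin> T \<and> is_SST P (insert f (T - {e}))"

text \<open>The U-clique of the common \<open>f\<close> links the I-cliques of \<open>e\<close> and
  \<open>e'\<close>.\<close>

definition exchange_rel :: "(real ^ 2) set \<Rightarrow> (real ^ 2) set set \<Rightarrow> ((real ^ 2) set \<times> (real ^ 2) set) set" where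
  "exchange_rel P T = {(e, e'). \<exists>f. exchange P T e f \<and> exchange P T e' f}"

lemma card_sym_diff_exchange:
  assumes "e \<in> T" "f \<notin> T"
  shows "card (sym_diff T (insert f (T - {e}))) = 2"
proof -
  have "sym_diff T (insert f (T - {e})) = {e, f}" "e \<noteq> f"
    using assms by auto
  then show ?thesis by simp
qed

lemma SST_arc_iff:
  assumes "is_SST P T"
  shows "(T, S) \<in> parcs (SST_graph P) \<longleftrightarrow> (\<exists>e f. exchange P T e f \<and> S = insert f (T - {e}))"
proof
  assume "(T, S) \<in> parcs (SST_graph P)"
  then have S: "is_SST P S" "card (sym_diff T S) = 2"
    by (simp_all add: SST_graph_simps)
  obtain e f where "e \<in> T" "f \<notin> T" "S = insert f (T - {e})"
    using bridge_tree_sym_diff[OF S(1)[THEN is_SST_bridge_tree] assms[THEN is_SST_bridge_tree] S(2)] .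
  then show "\<exists>e f. exchange P T e f \<and> S = insert f (T - {e})"
    using S(1) by (auto simp: exchange_def)
next
  assume "\<exists>e f. exchange P T e f \<and> S = insert f (T - {e})"
  then obtain e f where "exchange P T e f" "S = insert f (T - {e})"
    by blast
  then show "(T, S) \<in> parcs (SST_graph P)"
    using assms card_sym_diff_exchange[of e T f] by (simp add: SST_graph_simps exchange_def)
qed

text \<open>The right-hand side no longer mentions \<open>e\<close>, so U-cliques are indexed by the
  inserted edge; dually, I-cliques are indexed by the removed one.\<close>

lemma U_clique_exchange:
  "e \<in> T \<Longrightarrow> U_clique P T (insert f (T - {e})) = {C. is_SST P C \<and> C \<subseteq> insert f T}"
  by (auto simp: U_clique_def SST_graph_simps)

lemma I_clique_exchange:
  "f \<notin> T \<Longrightarrow> I_clique P T (insert f (T - {e})) = {C. is_SST P C \<and> T - {e} \<subseteq> C}"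
  by (auto simp: I_clique_def SST_graph_simps)

text \<open>A common member lies between \<open>T - {e}\<close> and \<open>insert f T\<close>. If it
  contains \<open>f\<close>, it contains the exchanged tree, otherwise it is contained in
  \<open>T\<close>; minimality of trees gives equality.\<close>

lemma card_U_Int_I:
  assumes T: "is_SST P T" and ef: "exchange P T e f"
  shows "card ({C. is_SST P C \<and> C \<subseteq> insert f T} \<inter> {C. is_SST P C \<and> T - {e} \<subseteq> C}) = 2"
proof -
  let ?S = "insert f (T - {e})"
  have S: "is_SST P ?S" "e \<in> T" "f \<notin> T"
    using ef by (auto simp: exchange_def)
  have "C = T \<or> C = ?S" if C: "is_SST P C" "C \<subseteq> insert f T" "T - {e} \<subseteq> C" for C
  proof (cases "f \<in> C")
    case True
    then have "?S \<subseteq> C" using C by auto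
    then show ?thesis
      using bridge_tree_subset_eq[OF S(1)[THEN is_SST_bridge_tree] C(1)[THEN is_SST_bridge_tree]] by simp
  next
    case False
    then have "C \<subseteq> T" using C by auto
    then show ?thesis
      using bridge_tree_subset_eq[OF C(1)[THEN is_SST_bridge_tree] T[THEN is_SST_bridge_tree]] by simp
  qed
  then have "{C. is_SST P C \<and> C \<subseteq> insert f T} \<inter> {C. is_SST P C \<and> T - {e} \<subseteq> C} = {T, ?S}"
    using T S by auto
  moreover have "T \<noteq> ?S" using S by auto
  ultimately show ?thesis by simp
qed

text \<open>Chains of exchanges become walks alternating between U-cliques and I-cliques. The given
  exchange makes the vertex set nonempty, and the I-clique of \<open>e0\<close> serves as a
  hub.\<close>

lemma connected_clique_graph:
  assumes T: "is_SST P T" and ex: "exchange P T e0 f0"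
    and rel: "\<And>e e'. e \<in> T \<Longrightarrow> e' \<in> T \<Longrightarrow> (e, e') \<in> (exchange_rel P T)\<^sup>*"
  shows "Digraph_Component.connected (with_proj (clique_graph P T))"
proof -
  define U where "U f = {C. is_SST P C \<and> C \<subseteq> insert f T}" for f
  define I where "I e = {C. is_SST P C \<and> T - {e} \<subseteq> C}" for e
  define R where "R = {(X, Y). X \<in> cliques_at P T \<and> Y \<in> cliques_at P T \<and> X \<noteq> Y \<and> card (X \<inter> Y) = 2}"
  have U: "U_clique P T (insert f (T - {e})) = U f" and I: "I_clique P T (insert f (T - {e})) = I e"
    if "exchange P T e f" for e f
    using that U_clique_exchange[of e T P f] I_clique_exchange[of f T P e]
    by (simp_all add: U_def I_def exchange_def)
  have cl: "X \<in> cliques_at P T \<longleftrightarrow> (\<exists>e f. exchange P T e f \<and> (X = U f \<or> X = I e))" for X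
  proof -
    have "X \<in> cliques_at P T \<longleftrightarrow>
      (\<exists>e f. exchange P T e f \<and> (X = U_clique P T (insert f (T - {e})) \<or> X = I_clique P T (insert f (T - {e}))))"
      unfolding cliques_at_def SST_arc_iff[OF T] Un_iff mem_Collect_eq by metis
    also have "\<dots> \<longleftrightarrow> (\<exists>e f. exchange P T e f \<and> (X = U f \<or> X = I e))"
      by (simp add: U I cong: conj_cong)
    finally show ?thesis .
  qed
  have symR: "sym R" and subR: "R \<subseteq> cliques_at P T \<times> cliques_at P T"
    by (auto simp: R_def sym_def Int_commute)
  \<comment> \<open>If the two cliques coincide, both are degenerate and there is no arc;
    reflexivity of the closure covers this case.\<close>
  have UI: "(U f, I e) \<in> R\<^sup>*" if "exchange P T e f" for e f
  proof (cases "U f = I e")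
    case False
    have "U f \<in> cliques_at P T" "I e \<in> cliques_at P T"
      using that unfolding cl by auto
    then have "(U f, I e) \<in> R"
      using False card_U_Int_I[OF T that] by (auto simp: R_def U_def I_def)
    then show ?thesis by auto
  qed auto
  have IU: "(I e, U f) \<in> R\<^sup>*" if "exchange P T e f" for e f
    using UI[OF that] sym_rtrancl[OF symR] by (meson symD)
  have II: "(I e, I e') \<in> R\<^sup>*" if "(e, e') \<in> (exchange_rel P T)\<^sup>*" for e e'
    using that
  proof (induction rule: rtrancl_induct)
    case base
    then show ?case by simp
  next
    case (step y z)
    then obtain f where "exchange P T y f" "exchange P T z f"
      by (auto simp: exchange_rel_def)
    then show ?case
      using step.IH UI IU by (meson rtrancl_trans)
  qed
  have base: "(X, I e0) \<in> R\<^sup>*" if X: "X \<in> cliques_at P T" for X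
  proof -
    obtain e f where ef: "exchange P T e f" "X = U f \<or> X = I e"
      using X unfolding cl by blast
    have "(e, e0) \<in> (exchange_rel P T)\<^sup>*"
      using rel ef(1) ex by (auto simp: exchange_def)
    then show ?thesis
      using ef II UI rtrancl_trans by metis
  qed
  have "(X, Y) \<in> R\<^sup>*" if "X \<in> cliques_at P T" "Y \<in> cliques_at P T" for X Y
    using base[OF that(1)] base[OF that(2)] sym_rtrancl[OF symR] by (meson symD rtrancl_trans)
  moreover have "I e0 \<in> cliques_at P T"
    unfolding cl using ex by blast
  moreover have "clique_graph P T = \<lparr>pverts = cliques_at P T, parcs = R\<rparr>"
    by (simp add: clique_graph_def R_def)
  ultimately show ?thesis
    using connected_with_proj_iff[OF symR subR] by auto
qed

subsection \<open>Uncrossed segments between two classes of branches\<close>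

lemma general_positionD:
  assumes "general_position P" "x \<in> P" "y \<in> P" "z \<in> P" "collinear {x, y, z}"
  shows "x = y \<or> y = z \<or> x = z"
  using assms by (auto simp: general_position_def)

lemma edges_cross_commute: "edges_cross e f \<longleftrightarrow> edges_cross f e"
  unfolding edges_cross_def by (metis (no_types, opaque_lifting) Int_commute distinct_length_2_or_more distinct_singleton)

lemma edges_crossI:
  assumes "distinct [a, b, c, d]" "z \<in> closed_segment a b" "z \<in> closed_segment c d"
  shows "edges_cross {a, b} {c, d}"
  using assms unfolding edges_cross_def by blast

text \<open>Affine coordinates with origin \<open>b\<close> and unit points \<open>a\<close> and
  \<open>c\<close>, obtained by Cramer's rule; \<open>cr\<close> is the determinant of two plane
  vectors.\<close>

lemma noncollinear_coordinates:
  fixes a b c :: "real ^ 2"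
  assumes "\<not> collinear {a, b, c}"
  obtains s t :: "real ^ 2 \<Rightarrow> real" where
    "\<And>w. w = b + s w *\<^sub>R (a - b) + t w *\<^sub>R (c - b)"
    "\<And>k u v. s ((1 - k) *\<^sub>R u + k *\<^sub>R v) = (1 - k) * s u + k * s v"
    "\<And>k u v. t ((1 - k) *\<^sub>R u + k *\<^sub>R v) = (1 - k) * t u + k * t v"
    "s a = 1" "t a = 0" "s b = 0" "t b = 0" "s c = 0" "t c = 1"
proof -
  define cr where "cr u v = u $ 1 * v $ 2 - u $ 2 * v $ 1" for u v :: "real ^ 2"
  define \<alpha> \<beta> where "\<alpha> = a - b" and "\<beta> = c - b"
  have ncol: "\<not> collinear {0, \<alpha>, \<beta>}"
    using assms by (simp add: collinear_3 \<alpha>_def \<beta>_def)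
  have D: "cr \<alpha> \<beta> \<noteq> 0"
  proof
    assume 0: "cr \<alpha> \<beta> = 0"
    have "\<alpha> \<noteq> 0"
      using ncol by (auto simp: collinear_lemma)
    then consider "\<alpha> $ 1 \<noteq> 0" | "\<alpha> $ 2 \<noteq> 0"
      by (auto simp: vec_eq_iff forall_2)
    then have "\<exists>k. \<beta> = k *\<^sub>R \<alpha>"
    proof cases
      case 1
      then have "\<beta> = (\<beta> $ 1 / \<alpha> $ 1) *\<^sub>R \<alpha>"
        using 0 by (simp add: vec_eq_iff forall_2 cr_def field_simps)
      then show ?thesis by blast
    next
      case 2
      then have "\<beta> = (\<beta> $ 2 / \<alpha> $ 2) *\<^sub>R \<alpha>"
        using 0 by (simp add: vec_eq_iff forall_2 cr_def field_simps)
      then show ?thesis by blast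
    qed
    then show False
      using ncol by (auto simp: collinear_lemma)
  qed
  define s where "s w = cr (w - b) \<beta> / cr \<alpha> \<beta>" for w
  define t where "t w = cr \<alpha> (w - b) / cr \<alpha> \<beta>" for w
  show thesis
  proof (rule that[of s t])
    show "w = b + s w *\<^sub>R (a - b) + t w *\<^sub>R (c - b)" for w
    proof -
      have "cr \<alpha> \<beta> * (w - b) $ i = cr (w - b) \<beta> * \<alpha> $ i + cr \<alpha> (w - b) * \<beta> $ i" for i
        using exhaust_2[of i] by (auto simp: cr_def algebra_simps)
      then have "(w - b) $ i = s w * \<alpha> $ i + t w * \<beta> $ i" for i
        using D by (simp add: s_def t_def field_simps)
      then show ?thesis
        by (simp add: vec_eq_iff \<alpha>_def \<beta>_def algebra_simps)
    qed
    show "s ((1 - k) *\<^sub>R u + k *\<^sub>R v) = (1 - k) * s u + k * s v"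
      "t ((1 - k) *\<^sub>R u + k *\<^sub>R v) = (1 - k) * t u + k * t v" for k u v
    proof -
      have "cr ((1 - k) *\<^sub>R u + k *\<^sub>R v - b) \<beta> = (1 - k) * cr (u - b) \<beta> + k * cr (v - b) \<beta>"
        "cr \<alpha> ((1 - k) *\<^sub>R u + k *\<^sub>R v - b) = (1 - k) * cr \<alpha> (u - b) + k * cr \<alpha> (v - b)"
        by (simp_all add: cr_def algebra_simps)
      then show "s ((1 - k) *\<^sub>R u + k *\<^sub>R v) = (1 - k) * s u + k * s v"
        "t ((1 - k) *\<^sub>R u + k *\<^sub>R v) = (1 - k) * t u + k * t v"
        by (simp_all add: s_def t_def add_divide_distrib)
    qed
    show "s a = 1" "t c = 1"
      using D by (simp_all add: s_def t_def \<alpha>_def \<beta>_def)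
    show "t a = 0" "s b = 0" "t b = 0" "s c = 0"
      by (simp_all add: s_def t_def \<alpha>_def \<beta>_def cr_def)
  qed
qed

text \<open>A nontrivial linear equation in the coordinates confines the points to the direction
  \<open>y *\<^sub>R \<alpha> - x *\<^sub>R \<beta>\<close>.\<close>

lemma collinear_level_line:
  fixes s t :: "'a::real_vector \<Rightarrow> real"
  assumes coords: "\<And>w. w \<in> A \<Longrightarrow> w = b + s w *\<^sub>R \<alpha> + t w *\<^sub>R \<beta>"
    and "x \<noteq> 0 \<or> y \<noteq> 0" and level: "\<And>w. w \<in> A \<Longrightarrow> x * s w + y * t w = m"
  shows "collinear A"
  unfolding collinear_def
proof (rule exI[of _ "y *\<^sub>R \<alpha> - x *\<^sub>R \<beta>"], intro ballI)
  fix v w assume vw: "v \<in> A" "w \<in> A"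
  have diff: "v - w = (s v - s w) *\<^sub>R \<alpha> + (t v - t w) *\<^sub>R \<beta>"
    by (subst coords[OF vw(1)], subst coords[OF vw(2)]) (simp add: algebra_simps)
  have eq: "x * (s v - s w) = - y * (t v - t w)"
    using level[OF vw(1)] level[OF vw(2)] by (simp add: algebra_simps)
  show "\<exists>c. v - w = c *\<^sub>R (y *\<^sub>R \<alpha> - x *\<^sub>R \<beta>)"
  proof (cases "x = 0")
    case True
    then have "t v - t w = 0" using eq assms(2) by simp
    then have "v - w = ((s v - s w) / y) *\<^sub>R (y *\<^sub>R \<alpha> - x *\<^sub>R \<beta>)"
      using True assms(2) diff by simp
    then show ?thesis by blast
  next
    case False
    define k where "k = (t v - t w) / x"
    have "t v - t w = x * k" "s v - s w = - y * k"
      using False eq by (simp_all add: k_def field_simps)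
    then have "v - w = (- k) *\<^sub>R (y *\<^sub>R \<alpha> - x *\<^sub>R \<beta>)"
      unfolding diff by (simp add: scaleR_diff_right mult.commute)
    then show ?thesis by blast
  qed
qed

section \<open>Supporting lines and the edges crossing them\<close>

lemma continuous_on_Min_image:
  fixes f :: "'a \<Rightarrow> 'b::topological_space \<Rightarrow> 'c::linorder_topology"
  assumes "finite A" "A \<noteq> {}" "\<And>w. w \<in> A \<Longrightarrow> continuous_on S (f w)"
  shows "continuous_on S (\<lambda>x. Min ((\<lambda>w. f w x) ` A))"
  using assms by (induction rule: finite_ne_induct) (auto intro: continuous_on_min)

text \<open>Rotating the direction of a supporting line from one axis to the other, at some moment
  it touches both \<open>X\<close> and \<open>Y\<close>.\<close>
lemma common_supporting_line:
  fixes s t :: "'a \<Rightarrow> real"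
  assumes fin: "finite X" "finite Y" and ac: "a \<in> X" "c \<in> Y" "t a = 0" "s c = 0"
    and pos: "\<And>w. w \<in> X \<Longrightarrow> 0 < s w" "\<And>w. w \<in> Y \<Longrightarrow> 0 < t w"
  obtains \<theta> p q where "0 < \<theta>" "\<theta> < 1" "p \<in> X" "q \<in> Y"
    "(1 - \<theta>) * s p + \<theta> * t p = (1 - \<theta>) * s q + \<theta> * t q"
    "\<And>w. w \<in> X \<union> Y \<Longrightarrow> (1 - \<theta>) * s p + \<theta> * t p \<le> (1 - \<theta>) * s w + \<theta> * t w"
proof -
  define l where "l w \<theta> = (1 - \<theta>) * s w + \<theta> * t w" for w \<theta>
  define m where "m A \<theta> = Min ((\<lambda>w. l w \<theta>) ` A)" for A \<theta>
  have ne: "X \<noteq> {}" "Y \<noteq> {}" using ac by auto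
  have attained: "\<exists>w\<in>A. l w \<theta> = m A \<theta>" if "finite A" "A \<noteq> {}" for A \<theta>
  proof -
    have "m A \<theta> \<in> (\<lambda>w. l w \<theta>) ` A"
      unfolding m_def by (rule Min_in) (use that in auto)
    then show ?thesis by force
  qed
  have le: "m A \<theta> \<le> l w \<theta>" if "finite A" "w \<in> A" for A w \<theta>
    unfolding m_def by (rule Min_le) (use that in auto)
  have cont: "continuous_on {0..1} (m A)" if "finite A" "A \<noteq> {}" for A
    unfolding m_def by (rule continuous_on_Min_image) (use that in \<open>auto simp: l_def intro!: continuous_intros\<close>)
  \<comment> \<open>At \<open>0\<close> the functional is \<open>s\<close>, positive on
    \<open>X\<close> but zero at \<open>c\<close>; at \<open>1\<close> it is \<open>t\<close>,
    positive on \<open>Y\<close> but zero at \<open>a\<close>. So the difference of the two minima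
    changes sign strictly in between.\<close>
  have "m Y 0 \<le> 0" "m X 1 \<le> 0"
    using le[OF fin(2) ac(2), of 0] le[OF fin(1) ac(1), of 1] ac by (simp_all add: l_def)
  moreover have X0: "0 < m X 0" and Y1: "0 < m Y 1"
    using attained[OF fin(1) ne(1), of 0] attained[OF fin(2) ne(2), of 1] pos
    by (fastforce simp: l_def)+
  ultimately have sgn: "m X 1 - m Y 1 < 0" "0 < m X 0 - m Y 0"
    by linarith+
  have "continuous_on {0..1} (\<lambda>\<theta>. m X \<theta> - m Y \<theta>)"
    by (intro continuous_on_diff cont fin ne)
  then obtain \<theta> where \<theta>: "0 \<le> \<theta>" "\<theta> \<le> 1" "m X \<theta> - m Y \<theta> = 0"
    using IVT2'[of "\<lambda>\<theta>. m X \<theta> - m Y \<theta>" 1 0 0] sgn by auto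
  then have "\<theta> \<noteq> 0" "\<theta> \<noteq> 1" using sgn by auto
  obtain p q where pq: "p \<in> X" "q \<in> Y" "l p \<theta> = m X \<theta>" "l q \<theta> = m Y \<theta>"
    using attained fin ne by metis
  show thesis
  proof (rule that[of \<theta> p q])
    show "(1 - \<theta>) * s p + \<theta> * t p = (1 - \<theta>) * s q + \<theta> * t q"
      using pq \<theta> by (simp add: l_def)
    show "(1 - \<theta>) * s p + \<theta> * t p \<le> (1 - \<theta>) * s w + \<theta> * t w" if "w \<in> X \<union> Y" for w
      using that le[OF fin(1), of w \<theta>] le[OF fin(2), of w \<theta>] pq \<theta> by (auto simp: l_def)
  qed (use \<theta> \<open>\<theta> \<noteq> 0\<close> \<open>\<theta> \<noteq> 1\<close> pq in auto)
qed

text \<open>A segment from inside the quadrant to a point outside meets one of the two bounding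
  half-axes.\<close>

lemma leaves_quadrant:
  fixes s t s' t' :: real
  assumes "0 < s" "0 < t" "s' < 0 \<or> t' < 0"
  obtains k where "0 \<le> k" "k \<le> 1"
    "(1 - k) * t + k * t' = 0 \<and> 0 \<le> (1 - k) * s + k * s' \<or>
     (1 - k) * s + k * s' = 0 \<and> 0 \<le> (1 - k) * t + k * t'"
proof -
  have comb: "(1 - x / (x - x')) * y + x / (x - x') * y' = (x * y' - x' * y) / (x - x')"
    if "0 < x" "x' < 0" for x x' y y' :: real
  proof -
    have "1 - x / (x - x') = - x' / (x - x')"
      using that by (simp add: field_simps)
    then show ?thesis
      by (simp add: diff_divide_distrib)
  qed
  have unit: "0 \<le> x / (x - x')" "x / (x - x') \<le> 1" if "0 < x" "x' < 0" for x x' :: real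
    using that by simp_all
  \<comment> \<open>The sign of the determinant \<open>s * t' - s' * t\<close> tells which half-axis
    is met; the parameter is the zero of the corresponding coordinate.\<close>
  show thesis
  proof (cases "s' < 0 \<and> 0 \<le> s * t' - s' * t")
    case True
    show ?thesis
      by (rule that[of "s / (s - s')"]) (use True assms unit[of s s'] comb[of s s'] in auto)
  next
    case False
    then have "t' < 0"
      using assms by (smt (verit) mult_nonneg_nonneg mult_neg_pos)
    moreover have "0 \<le> t * s' - t' * s"
      using False assms \<open>t' < 0\<close> by (smt (verit) mult_nonneg_nonneg mult_neg_pos mult.commute)
    ultimately show ?thesis
      by (intro that[of "t / (t - t')"]) (use assms unit[of t t'] comb[of t t'] in auto)
  qed
qed

text \<open>A crossing edge has an end strictly below the supporting line. By minimality this end is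
  \<open>b\<close> or lies outside the angle; in the latter case the edge leaves the angle through
  the segment \<open>ab\<close> or \<open>bc\<close>, which is excluded.\<close>

lemma supporting_segment_crossed:
  fixes s t :: "real ^ 2 \<Rightarrow> real"
  assumes coords: "\<And>w. w = b + s w *\<^sub>R (a - b) + t w *\<^sub>R (c - b)"
    and aff: "\<And>k u v. s ((1 - k) *\<^sub>R u + k *\<^sub>R v) = (1 - k) * s u + k * s v"
      "\<And>k u v. t ((1 - k) *\<^sub>R u + k *\<^sub>R v) = (1 - k) * t u + k * t v"
    and abc: "s a = 1" "t a = 0" "s b = 0" "t b = 0" "s c = 0" "t c = 1"
    and gp: "general_position P" and P: "{a, b, c, p, q, u, v} \<subseteq> P"
    and \<theta>: "0 < \<theta>" "\<theta> < 1"
    and pq: "0 < s p" "0 \<le> t p" "0 \<le> s q" "0 < t q"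
      "(1 - \<theta>) * s p + \<theta> * t p = (1 - \<theta>) * s q + \<theta> * t q"
    and min: "\<And>w. w \<in> P \<Longrightarrow> w \<noteq> b \<Longrightarrow> 0 \<le> s w \<Longrightarrow> 0 \<le> t w \<Longrightarrow>
      (1 - \<theta>) * s p + \<theta> * t p \<le> (1 - \<theta>) * s w + \<theta> * t w"
    and cross: "edges_cross {p, q} {u, v}"
    and uncrossed: "\<not> edges_cross {u, v} {a, b}" "\<not> edges_cross {u, v} {b, c}"
  obtains w where "{u, v} = {b, w}" "0 < s w" "0 < t w"
proof -
  define l where "l w = (1 - \<theta>) * s w + \<theta> * t w" for w
  define m where "m = l p"
  have laff: "l ((1 - k) *\<^sub>R x + k *\<^sub>R y) = (1 - k) * l x + k * l y" for k x y
    unfolding l_def aff by (simp add: algebra_simps)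
  have lq: "l q = m"
    using pq by (simp add: l_def m_def)
  have mpos: "0 < m"
    using pq \<theta> unfolding l_def m_def by (intro add_pos_nonneg) auto
  have lmin: "m \<le> l w" if "w \<in> P" "w \<noteq> b" "0 \<le> s w" "0 \<le> t w" for w
    using min[OF that] by (simp add: l_def m_def)
  have dist: "a \<noteq> b" "b \<noteq> c" "a \<noteq> c" using abc by auto
  have lab: "m \<le> l a" "m \<le> l c" "l b = 0"
    using lmin[of a] lmin[of c] P abc dist by (auto simp: l_def)
  obtain x y z where xy: "{u, v} = {x, y}" "distinct [p, q, x, y]"
    "z \<in> closed_segment p q" "z \<in> closed_segment x y"
    using cross unfolding edges_cross_def
    by (smt (verit) closed_segment_commute disjoint_iff distinct_length_2_or_more doubleton_eq_iff)
  have xyP: "x \<in> P" "y \<in> P" using xy(1) P by (auto simp: doubleton_eq_iff)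
  \<comment> \<open>A third point of \<open>P\<close> on the supporting line would violate general
    position.\<close>
  have ne_m: "l w \<noteq> m" if "w \<in> P" "w \<noteq> p" "w \<noteq> q" for w
  proof
    assume "l w = m"
    have "collinear {p, q, w}"
      by (rule collinear_level_line[where s = s and t = t and x = "1 - \<theta>" and y = \<theta> and m = m])
        (use coords \<theta> \<open>l w = m\<close> lq in \<open>auto simp: l_def m_def\<close>)
    then show False
      using general_positionD[OF gp, of p q w] P that xy(2) by auto
  qed
  obtain j where j: "0 \<le> j" "j \<le> 1" "z = (1 - j) *\<^sub>R p + j *\<^sub>R q"
    using xy(3) by (auto simp: in_segment)
  have lz: "l z = m"
    using lq unfolding j(3) laff by (simp add: m_def algebra_simps)
  \<comment> \<open>The level of \<open>z\<close> is a weighted mean of the levels of both ends,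
    neither of which is \<open>m\<close>, so the ends lie strictly on opposite sides.\<close>
  obtain u' v' where uv: "{u, v} = {u', v'}" "distinct [p, q, u', v']" "z \<in> closed_segment u' v'"
    "l u' < m" "m < l v'" "u' \<in> P" "v' \<in> P"
  proof -
    obtain i where i: "0 \<le> i" "i \<le> 1" "z = (1 - i) *\<^sub>R x + i *\<^sub>R y"
      using xy(4) by (auto simp: in_segment)
    have eq: "(1 - i) * (l x - m) + i * (l y - m) = 0"
      using lz unfolding i(3) laff by (simp add: algebra_simps)
    have ne: "l x - m \<noteq> 0" "l y - m \<noteq> 0"
      using ne_m xy(2) xyP by auto
    consider "l x < m" "m < l y" | "l y < m" "m < l x"
    proof -
      have "\<not> (0 < l x - m \<and> 0 < l y - m)"
        using eq i by (smt (verit) mult_nonneg_nonneg mult_pos_pos)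
      moreover have "\<not> (l x - m < 0 \<and> l y - m < 0)"
        using eq i by (smt (verit) mult_nonneg_nonpos mult_pos_neg)
      ultimately have "l x < m \<and> m < l y \<or> l y < m \<and> m < l x"
        using ne by linarith
      then show thesis
        using that by blast
    qed
    then show thesis
    proof cases
      case 1
      then show ?thesis using that[of x y] xy xyP by auto
    next
      case 2
      then show ?thesis
        using that[of y x] xy xyP by (auto simp: insert_commute closed_segment_commute)
    qed
  qed
  obtain i where i: "0 \<le> i" "i \<le> 1" "z = (1 - i) *\<^sub>R u' + i *\<^sub>R v'"
    using uv(3) by (auto simp: in_segment)
  have collinear_between: "collinear {u', w, v'}" if "w \<in> closed_segment u' v'" for w
    using that between_imp_collinear[of u' v' w] by (simp add: between_mem_segment)
  \<comment> \<open>Otherwise \<open>p\<close> or \<open>q\<close> would lie on the segment between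
    \<open>u'\<close> and \<open>v'\<close>. So \<open>z\<close> is interior to \<open>pq\<close>
    and both its coordinates are positive.\<close>
  have "z \<noteq> p" "z \<noteq> q"
    using collinear_between[OF uv(3)] general_positionD[OF gp, of u' z v'] uv P by auto
  then have "0 < j" "j < 1"
    using j by (auto simp: less_le)
  then have sz: "0 < s z" and tz: "0 < t z"
    using pq by (auto simp: j(3) aff add_pos_nonneg add_nonneg_pos)
  have "v' \<noteq> b"
    using uv(5) mpos lab by auto
  show thesis
  proof (cases "u' = b")
    case True
    then have "0 < i * s v'" "0 < i * t v'"
      using sz tz i(3) abc by (simp_all add: aff)
    then have "0 < s v'" "0 < t v'"
      using i(1) by (simp_all add: zero_less_mult_iff)
    then show ?thesis
      using that uv(1) True by blast
  next
    case False
    have "s u' < 0 \<or> t u' < 0"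
      using lmin[OF uv(6) False] uv(4) by linarith
    then obtain k where k: "0 \<le> k" "k \<le> 1"
      "(1 - k) * t z + k * t u' = 0 \<and> 0 \<le> (1 - k) * s z + k * s u' \<or>
       (1 - k) * s z + k * s u' = 0 \<and> 0 \<le> (1 - k) * t z + k * t u'"
      using leaves_quadrant[OF sz tz] by blast
    have conv: "0 < (1 - k) * x + k * y" if "0 < x" "0 < y" for x y
      using that k(1,2) by (cases "k = 0") (auto intro: add_nonneg_pos)
    define y where "y = (1 - k) *\<^sub>R z + k *\<^sub>R u'"
    have y_seg: "y \<in> closed_segment u' v'"
    proof -
      have "y \<in> closed_segment z u'"
        unfolding y_def in_segment using k by blast
      then show ?thesis
        using uv(3) subset_closed_segment[of z u' u' v'] by auto
    qed
    \<comment> \<open>Going from \<open>z\<close> towards \<open>u'\<close> the level does not rise,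
      so the exit point \<open>y\<close> is no higher than \<open>a\<close> and \<open>c\<close>.
      This keeps it from lying beyond \<open>a\<close> or \<open>c\<close> on its ray.\<close>
    have "l y = m + k * (l u' - m)"
      unfolding y_def laff lz by (simp add: algebra_simps)
    then have ly: "l y \<le> m"
      using k(1) uv(4) mult_nonneg_nonpos[of k "l u' - m"] by simp
    have u'_ne: "u' \<noteq> a" "u' \<noteq> c"
      using uv(4) lab by auto
    consider (t) "t y = 0" "0 \<le> s y" | (s) "s y = 0" "0 \<le> t y"
      using k(3) by (auto simp: y_def aff)
    then show ?thesis
    proof cases
      case t
      \<comment> \<open>A crossing needs four distinct endpoints. With \<open>v' = a\<close> on the
        axis, positivity of \<open>t z\<close> would force \<open>t u'\<close>, and then
        \<open>t y\<close>, to be positive.\<close>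
      have "v' \<noteq> a"
      proof
        assume "v' = a"
        then have "t z = (1 - i) * t u'" using i(3) abc by (simp add: aff)
        then have "0 < t u'" using tz i by (auto simp: zero_less_mult_iff)
        then have "0 < t y"
          using tz conv by (simp add: y_def aff)
        then show False using t by simp
      qed
      have "(1 - \<theta>) * s y \<le> (1 - \<theta>) * 1"
        using ly lab(1) t abc by (simp add: l_def)
      then have "s y \<le> 1"
        using \<theta> by (subst (asm) mult_le_cancel_left_pos) auto
      moreover have "y = (1 - s y) *\<^sub>R b + s y *\<^sub>R a"
        using coords[of y] t by (simp add: algebra_simps)
      ultimately have "y \<in> closed_segment a b"
        using t unfolding closed_segment_commute[of a b] in_segment by blast
      then have "edges_cross {u', v'} {a, b}"
        using y_seg uv(2) u'_ne \<open>v' \<noteq> a\<close> \<open>v' \<noteq> b\<close> False dist by (intro edges_crossI) auto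
      then show ?thesis using uncrossed uv(1) by simp
    next
      case s
      have "v' \<noteq> c"
      proof
        assume "v' = c"
        then have "s z = (1 - i) * s u'" using i(3) abc by (simp add: aff)
        then have "0 < s u'" using sz i by (auto simp: zero_less_mult_iff)
        then have "0 < s y"
          using sz conv by (simp add: y_def aff)
        then show False using s by simp
      qed
      have "\<theta> * t y \<le> \<theta> * 1"
        using ly lab(2) s abc by (simp add: l_def)
      then have "t y \<le> 1"
        using \<theta> by (subst (asm) mult_le_cancel_left_pos) auto
      moreover have "y = (1 - t y) *\<^sub>R b + t y *\<^sub>R c"
        using coords[of y] s by (simp add: algebra_simps)
      ultimately have "y \<in> closed_segment b c"
        using s unfolding in_segment by blast
      then have "edges_cross {u', v'} {b, c}"
        using y_seg uv(2) u'_ne \<open>v' \<noteq> c\<close> \<open>v' \<noteq> b\<close> False dist by (intro edges_crossI) auto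
      then show ?thesis using uncrossed uv(1) by simp
    qed
  qed
qed

section \<open>Choice of an empty angle at a vertex\<close>

lemma collinear_cone_self:
  fixes w b c :: "'a::euclidean_space"
  assumes "w - b = x *\<^sub>R (w - b) + y *\<^sub>R (c - b)" "y \<noteq> 0"
  shows "collinear {w, b, c}"
proof -
  have "y *\<^sub>R (c - b) = (1 - x) *\<^sub>R (w - b)"
    using assms(1) by (simp add: algebra_simps)
  then have "(1 / y) *\<^sub>R (y *\<^sub>R (c - b)) = (1 / y) *\<^sub>R ((1 - x) *\<^sub>R (w - b))"
    by simp
  then have "c - b = ((1 - x) / y) *\<^sub>R (w - b)"
    using assms(2) by simp
  then have "collinear {0, w - b, c - b}"
    unfolding collinear_lemma by blast
  then show ?thesis
    by (simp add: collinear_3)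
qed

lemma uncrossed_pair:
  assumes fin: "finite P" and gp: "general_position P" and F: "F \<subseteq> complete_edges P"
    and nc: "\<And>e f. e \<in> F \<Longrightarrow> f \<in> F \<Longrightarrow> \<not> edges_cross e f"
    and b: "b \<in> P" and XY: "X \<union> Y = P - {b}" "X \<inter> Y = {}"
    and nbrs: "a0 \<in> X" "{b, a0} \<in> F" "c0 \<in> Y" "{b, c0} \<in> F"
  obtains p q where "p \<in> X" "q \<in> Y" "\<And>g. g \<in> F \<Longrightarrow> \<not> edges_cross {p, q} g"
proof -
  \<comment> \<open>Neighbours of \<open>b\<close> strictly inside the angle spanned by
    \<open>a\<close> and \<open>c\<close>. Among the candidate angles in \<open>pairs\<close>, one
    with the fewest such neighbours is taken.\<close>
  define cone where
    "cone a c = {w. {b, w} \<in> F \<and> (\<exists>x y. 0 < x \<and> 0 < y \<and> w - b = x *\<^sub>R (a - b) + y *\<^sub>R (c - b))}"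
    for a c
  have nbr_P: "w \<in> P - {b}" if "{b, w} \<in> F" for w
    using subsetD[OF F that] by auto
  have fin_cone: "finite (cone a c)" for a c
    by (rule finite_subset[OF _ fin]) (use nbr_P in \<open>auto simp: cone_def\<close>)
  define pairs where "pairs = {(a, c). a \<in> X \<and> c \<in> Y \<and> {b, a} \<in> F \<and> {b, c} \<in> F}"
  have "(a0, c0) \<in> pairs"
    using nbrs by (simp add: pairs_def)
  then obtain ac where ac: "ac \<in> pairs"
    "\<And>ac'. ac' \<in> pairs \<Longrightarrow> card (cone (fst ac) (snd ac)) \<le> card (cone (fst ac') (snd ac'))"
    using ex_has_least_nat[of "\<lambda>ac. ac \<in> pairs" "(a0, c0)" "\<lambda>ac. card (cone (fst ac) (snd ac))"] by blast
  define a c where "a = fst ac" and "c = snd ac"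
  have a: "a \<in> X" "{b, a} \<in> F" and c: "c \<in> Y" "{b, c} \<in> F"
    using ac(1) by (auto simp: pairs_def a_def c_def)
  have least: "card (cone a c) \<le> card (cone a' c')"
    if "a' \<in> X" "{b, a'} \<in> F" "c' \<in> Y" "{b, c'} \<in> F" for a' c'
    using ac(2)[of "(a', c')"] that by (simp add: pairs_def a_def c_def)
  have noncol: "\<not> collinear {x, b, y}" if "x \<in> X" "y \<in> Y" for x y
    using general_positionD[OF gp, of x b y] that XY b by blast
  \<comment> \<open>A neighbour \<open>w\<close> inside the angle could replace \<open>a\<close> or
    \<open>c\<close>, according to its class. The new cone is contained in the old one and loses
    \<open>w\<close>, against minimality.\<close>
  have empty: "w \<notin> cone a c" for w
  proof
    assume w: "w \<in> cone a c"
    then obtain x y where xy: "0 < x" "0 < y" "w - b = x *\<^sub>R (a - b) + y *\<^sub>R (c - b)"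
      by (auto simp: cone_def)
    have wF: "{b, w} \<in> F"
      using w by (simp add: cone_def)
    then consider "w \<in> X" | "w \<in> Y"
      using nbr_P XY by blast
    then show False
    proof cases
      case 1
      have "w \<notin> cone w c"
        using noncol[OF 1 c(1)] collinear_cone_self[of w b _ _ c] by (auto simp: cone_def)
      moreover have "cone w c \<subseteq> cone a c"
      proof
        fix v assume "v \<in> cone w c"
        then obtain x' y' where v: "{b, v} \<in> F" "0 < x'" "0 < y'"
          "v - b = x' *\<^sub>R (w - b) + y' *\<^sub>R (c - b)"
          by (auto simp: cone_def)
        have "v - b = (x' * x) *\<^sub>R (a - b) + (x' * y + y') *\<^sub>R (c - b)"
          unfolding v(4) xy(3) by (simp add: scaleR_add_right scaleR_add_left)
        moreover have "0 < x' * x" "0 < x' * y + y'"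
          using v xy by (simp_all add: add_pos_pos)
        ultimately show "v \<in> cone a c"
          using v(1) unfolding cone_def by blast
      qed
      ultimately have "card (cone w c) < card (cone a c)"
        using w fin_cone by (intro psubset_card_mono) auto
      then show False
        using least[OF 1 wF c] by simp
    next
      case 2
      have "w \<notin> cone a w"
      proof
        assume "w \<in> cone a w"
        then obtain x y where "0 < x" "w - b = x *\<^sub>R (a - b) + y *\<^sub>R (w - b)"
          by (auto simp: cone_def)
        then have "collinear {w, b, a}"
          using collinear_cone_self[of w b y x a] by (simp add: add.commute)
        then show False
          using noncol[OF a(1) 2] by (simp add: insert_commute)
      qed
      moreover have "cone a w \<subseteq> cone a c"
      proof
        fix v assume "v \<in> cone a w"
        then obtain x' y' where v: "{b, v} \<in> F" "0 < x'" "0 < y'"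
          "v - b = x' *\<^sub>R (a - b) + y' *\<^sub>R (w - b)"
          by (auto simp: cone_def)
        have "v - b = (x' + y' * x) *\<^sub>R (a - b) + (y' * y) *\<^sub>R (c - b)"
          unfolding v(4) xy(3) by (simp add: scaleR_add_right scaleR_add_left)
        moreover have "0 < x' + y' * x" "0 < y' * y"
          using v xy by (simp_all add: add_pos_pos)
        ultimately show "v \<in> cone a c"
          using v(1) unfolding cone_def by blast
      qed
      ultimately have "card (cone a w) < card (cone a c)"
        using w fin_cone by (intro psubset_card_mono) auto
      then show False
        using least[OF a 2 wF] by simp
    qed
  qed
  obtain s t :: "real ^ 2 \<Rightarrow> real" where
    coords: "\<And>w. w = b + s w *\<^sub>R (a - b) + t w *\<^sub>R (c - b)"
    and aff: "\<And>k u v. s ((1 - k) *\<^sub>R u + k *\<^sub>R v) = (1 - k) * s u + k * s v"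
      "\<And>k u v. t ((1 - k) *\<^sub>R u + k *\<^sub>R v) = (1 - k) * t u + k * t v"
    and abc: "s a = 1" "t a = 0" "s b = 0" "t b = 0" "s c = 0" "t c = 1"
    using noncollinear_coordinates[OF noncol[OF a(1) c(1)]] by metis
  define Q where "Q A = {w \<in> A. 0 \<le> s w \<and> 0 \<le> t w}" for A
  \<comment> \<open>A point of \<open>X\<close> on the line through \<open>b\<close> and
    \<open>c\<close> would violate general position, as \<open>c\<close> is in
    \<open>Y\<close>.\<close>
  have s_pos: "0 < s w" if "w \<in> Q X" for w
  proof -
    have "collinear {w, b, c}" if "s w = 0"
      by (rule collinear_level_line[where s = s and t = t and x = 1 and y = 0 and m = 0])
        (use coords abc that in auto)
    then show ?thesis
      using noncol[of w c] that c(1) by (force simp: Q_def less_le)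
  qed
  have t_pos: "0 < t w" if "w \<in> Q Y" for w
  proof -
    have "collinear {a, b, w}" if "t w = 0"
      by (rule collinear_level_line[where s = s and t = t and x = 0 and y = 1 and m = 0])
        (use coords abc that in auto)
    then show ?thesis
      using noncol[of a w] that a(1) by (force simp: Q_def less_le)
  qed
  have finXY: "finite X" "finite Y"
    using XY(1) fin by (metis finite_Diff finite_Un)+
  obtain \<theta> p q where \<theta>: "0 < \<theta>" "\<theta> < 1" and p: "p \<in> Q X" and q: "q \<in> Q Y"
    and eq: "(1 - \<theta>) * s p + \<theta> * t p = (1 - \<theta>) * s q + \<theta> * t q"
    and min: "\<And>w. w \<in> Q X \<union> Q Y \<Longrightarrow> (1 - \<theta>) * s p + \<theta> * t p \<le> (1 - \<theta>) * s w + \<theta> * t w"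
  proof (rule common_supporting_line[of "Q X" "Q Y" a c t s])
    show "finite (Q X)" "finite (Q Y)" "a \<in> Q X" "c \<in> Q Y"
      using finXY a c abc by (auto simp: Q_def)
  qed (use abc s_pos t_pos in auto)
  have "\<not> edges_cross {p, q} g" if g: "g \<in> F" for g
  proof
    assume cross: "edges_cross {p, q} g"
    have "g \<in> complete_edges P"
      using g F by blast
    then obtain u v where uv: "g = {u, v}" "u \<in> P" "v \<in> P"
      unfolding complete_edges_def by blast
    have "{a, b, c, p, q, u, v} \<subseteq> P"
      using a(1) b c(1) p q uv XY(1) by (auto simp: Q_def)
    moreover have "(1 - \<theta>) * s p + \<theta> * t p \<le> (1 - \<theta>) * s w + \<theta> * t w"
      if "w \<in> P" "w \<noteq> b" "0 \<le> s w" "0 \<le> t w" for w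
      using min[of w] that XY(1) by (auto simp: Q_def)
    moreover have "\<not> edges_cross {u, v} {a, b}" "\<not> edges_cross {u, v} {b, c}"
      using nc[OF g a(2)] nc[OF g c(2)] uv(1) by (simp_all add: insert_commute)
    \<comment> \<open>The only possible crossing edge starts at \<open>b\<close> and runs into the
      open angle, which contains no neighbour of \<open>b\<close>.\<close>
    ultimately obtain w where w: "{u, v} = {b, w}" "0 < s w" "0 < t w"
      using supporting_segment_crossed[OF coords aff abc gp _ \<theta> _ _ _ _ eq, of u v]
        p q s_pos[OF p] t_pos[OF q] cross uv(1) unfolding Q_def by blast
    have "w - b = s w *\<^sub>R (a - b) + t w *\<^sub>R (c - b)"
      using coords[of w] by (metis add.assoc add_diff_cancel_left')
    then have "w \<in> cone a c"
      using w g uv(1) by (auto simp: cone_def)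
    then show False
      using empty by blast
  qed
  then show thesis
    using that p q by (auto simp: Q_def)
qed

subsection \<open>Edges of a tree are related by exchanges\<close>

text \<open>Cut the walk at its last visit to \<open>b\<close>: the next vertex \<open>c\<close> is
  the root of the branch at \<open>b\<close> that contains \<open>q\<close>.\<close>

lemma joined_avoiding:
  assumes "joined F b q" "q \<noteq> b"
  obtains c where "c \<noteq> b" "{b, c} \<in> F" "joined {g \<in> F. b \<notin> g} c q"
proof -
  have "q = b \<or> (\<exists>c. c \<noteq> b \<and> {b, c} \<in> F \<and> joined {g \<in> F. b \<notin> g} c q)"
    using assms(1)
  proof (induction rule: rtrancl_induct)
    case base
    then show ?case by simp
  next
    case (step y z)
    then have yz: "y \<noteq> z" "{y, z} \<in> F"
      by (auto simp: edge_rel_def)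
    show ?case
    proof (cases "y = b \<or> z = b")
      case True
      then show ?thesis using yz by auto
    next
      case False
      then obtain c where c: "c \<noteq> b" "{b, c} \<in> F" "joined {g \<in> F. b \<notin> g} c y"
        using step.IH by auto
      moreover have "(y, z) \<in> edge_rel {g \<in> F. b \<notin> g}"
        using yz False by (auto simp: edge_rel_def)
      ultimately show ?thesis
        by (meson rtrancl_into_rtrancl)
    qed
  qed
  then show thesis using assms(2) that by auto
qed

text \<open>After removal of \<open>{b, a}\<close> the branch of \<open>p\<close> hangs on
  \<open>a\<close>, while \<open>q\<close> is still joined to \<open>b\<close> through
  \<open>c\<close>; so \<open>{p, q}\<close> reconnects the two sides.\<close>

lemma exchange_at_vertex:
  assumes T: "is_SST P T" and ac: "{b, a} \<in> T" "{b, c} \<in> T" "a \<noteq> b" "c \<noteq> b" "a \<noteq> c"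
    and p: "joined {g \<in> T. b \<notin> g} a p" and q: "joined {g \<in> T. b \<notin> g} c q"
    and pq: "p \<in> P" "q \<in> P" "p \<noteq> q" "{p, q} \<notin> T" "\<And>g. g \<in> T \<Longrightarrow> \<not> edges_cross {p, q} g"
  shows "exchange P T {b, a} {p, q}"
proof -
  let ?R = "T - {{a, b}}"
  have "joined ?R a p"
    using p by (rule joined_mono) auto
  moreover have "joined ?R b q"
  proof (rule joined_trans)
    show "joined ?R b c"
      using ac by (intro joined_edge) (auto simp: doubleton_eq_iff)
    show "joined ?R c q"
      using q by (rule joined_mono) auto
  qed
  ultimately have "bridge_tree P (insert {p, q} ?R)"
    using ac(1,3) pq is_SST_bridge_tree[OF T]
    by (intro bridge_tree_exchange) (auto simp: insert_commute)
  moreover have "\<not> edges_cross {p, q} {p, q}"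
    by (auto simp: edges_cross_def doubleton_eq_iff)
  then have "\<not> edges_cross e f" if "e \<in> insert {p, q} ?R" "f \<in> insert {p, q} ?R" for e f
    using that pq(5) T edges_cross_commute unfolding is_SST_def by blast
  ultimately show ?thesis
    using ac(1) pq(4) by (auto simp: exchange_def is_SST_def spanning_tree_edges_iff insert_commute)
qed

text \<open>The branches at \<open>b\<close> cannot split into two unrelated classes, since an
  uncrossed segment between the classes is a common replacement for one edge of each.\<close>

lemma exchange_rel_at_vertex:
  assumes fin: "finite P" and gp: "general_position P" and T: "is_SST P T"
    and a0: "{b, a0} \<in> T" and c0: "{b, c0} \<in> T"
  shows "({b, a0}, {b, c0}) \<in> (exchange_rel P T)\<^sup>*"
proof (rule ccontr)
  assume unrelated: "\<not> ?thesis"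
  \<comment> \<open>\<open>N\<close> holds the neighbours whose edges are chained to
    \<open>{b, a0}\<close>, and \<open>X\<close> is the union of their branches.\<close>
  define N where "N = {a. {b, a} \<in> T \<and> ({b, a0}, {b, a}) \<in> (exchange_rel P T)\<^sup>*}"
  define R where "R = {g \<in> T. b \<notin> g}"
  define X where "X = {w. \<exists>a\<in>N. joined R a w}"
  define Y where "Y = P - {b} - X"
  have tree: "bridge_tree P T"
    using T by (rule is_SST_bridge_tree)
  then have TP: "T \<subseteq> complete_edges P"
    by (simp add: bridge_tree_def)
  have bP: "b \<in> P" and nbr: "w \<in> P" "w \<noteq> b" if "{b, w} \<in> T" for w
    using subsetD[OF TP that] by auto
  have R_closed: "w \<in> P - {b}" if "joined R v w" "v \<in> P - {b}" for v w
    using that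
  proof (induction rule: rtrancl_induct)
    case (step y z)
    then have "{y, z} \<in> T" "z \<noteq> b"
      by (auto simp: edge_rel_def R_def)
    then show ?case
      using TP by auto
  qed auto
  have X: "X \<subseteq> P - {b}"
    using R_closed nbr by (fastforce simp: X_def N_def)
  have "a0 \<in> X"
    using a0 by (auto simp: X_def N_def)
  \<comment> \<open>Otherwise \<open>c0\<close> lies in the branch of another neighbour
    \<open>a\<close>, and the way from \<open>a\<close> over \<open>c0\<close> to \<open>b\<close>
    bypasses the bridge \<open>{a, b}\<close>.\<close>
  have "c0 \<notin> X"
  proof
    assume "c0 \<in> X"
    then obtain a where a: "{b, a} \<in> T" "joined R a c0" "a \<noteq> c0"
      using unrelated by (auto simp: X_def N_def)
    have "joined (T - {{a, b}}) a c0"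
      using a(2) by (rule joined_mono) (auto simp: R_def)
    moreover have "joined (T - {{a, b}}) c0 b"
      using c0 a(3) nbr[OF c0] by (intro joined_edge) (auto simp: doubleton_eq_iff insert_commute)
    ultimately have "joined (T - {{a, b}}) a b"
      by (rule joined_trans)
    then show False
      using tree a(1) nbr[OF a(1)] by (auto simp: bridge_tree_def insert_commute)
  qed
  then have "c0 \<in> Y"
    using nbr[OF c0] by (simp add: Y_def)
  have XY: "X \<union> Y = P - {b}" "X \<inter> Y = {}"
    using X by (auto simp: Y_def)
  have nc: "\<not> edges_cross e f" if "e \<in> T" "f \<in> T" for e f
    using T that by (simp add: is_SST_def)
  obtain p q where p: "p \<in> X" and q: "q \<in> Y" and pq: "\<And>g. g \<in> T \<Longrightarrow> \<not> edges_cross {p, q} g"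
    using uncrossed_pair[OF fin gp TP nc bP[OF a0] XY \<open>a0 \<in> X\<close> a0 \<open>c0 \<in> Y\<close> c0] by blast
  have pqP: "p \<in> P" "q \<in> P" "p \<noteq> b" "q \<noteq> b" "p \<noteq> q"
    using p q XY by auto
  obtain a where a: "a \<in> N" "joined R a p"
    using p by (auto simp: X_def)
  have "joined T b q"
    using tree bP[OF a0] pqP by (simp add: bridge_tree_def)
  then obtain c where c: "c \<noteq> b" "{b, c} \<in> T" "joined R c q"
    unfolding R_def using pqP(4) by (rule joined_avoiding)
  have "c \<notin> N"
    using q c(3) by (auto simp: Y_def X_def)
  have aT: "{b, a} \<in> T" "({b, a0}, {b, a}) \<in> (exchange_rel P T)\<^sup>*"
    using a by (simp_all add: N_def)
  have ac: "a \<noteq> c" "a \<noteq> b"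
    using a \<open>c \<notin> N\<close> nbr[OF aT(1)] by auto
  \<comment> \<open>As an edge of \<open>T\<close> avoiding \<open>b\<close> it would put
    \<open>q\<close> into the branch of \<open>p\<close>.\<close>
  have "{p, q} \<notin> T"
  proof
    assume "{p, q} \<in> T"
    then have "(p, q) \<in> edge_rel R"
      using pqP by (auto simp: edge_rel_def R_def)
    then have "q \<in> X"
      using a by (auto simp: X_def intro: rtrancl_into_rtrancl)
    then show False
      using q XY by auto
  qed
  then have "exchange P T {b, a} {p, q}" "exchange P T {b, c} {q, p}"
    using exchange_at_vertex[OF T aT(1) c(2) ac(2) c(1) ac(1), of p q]
      exchange_at_vertex[OF T c(2) aT(1) c(1) ac(2) ac(1)[symmetric], of q p]
      a(2) c(3) pqP pq by (simp_all add: R_def insert_commute)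
  then have "({b, a}, {b, c}) \<in> exchange_rel P T"
    by (auto simp: exchange_rel_def insert_commute)
  then have "c \<in> N"
    using aT(2) c(2) by (auto simp: N_def intro: rtrancl_into_rtrancl)
  then show False
    using \<open>c \<notin> N\<close> by simp
qed

text \<open>Walking through the tree, the induction relates \<open>e\<close> to all edges at each
  vertex reached; consecutive edges of the walk share a vertex.\<close>

lemma exchange_rel_connected:
  assumes fin: "finite P" and gp: "general_position P" and T: "is_SST P T"
    and e: "e \<in> T" and e': "e' \<in> T"
  shows "(e, e') \<in> (exchange_rel P T)\<^sup>*"
proof -
  have tree: "bridge_tree P T"
    using T by (rule is_SST_bridge_tree)
  then have TP: "T \<subseteq> complete_edges P"
    by (simp add: bridge_tree_def)
  obtain u v where uv: "e = {u, v}" "u \<in> P"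
    using e TP unfolding complete_edges_def by blast
  obtain x y where xy: "e' = {x, y}" "x \<in> P"
    using e' TP unfolding complete_edges_def by blast
  have "\<forall>w'. {w, w'} \<in> T \<longrightarrow> (e, {w, w'}) \<in> (exchange_rel P T)\<^sup>*" if "joined T u w" for w
    using that
  proof (induction rule: rtrancl_induct)
    case base
    then show ?case
      using exchange_rel_at_vertex[OF fin gp T, of u v] e uv(1) by blast
  next
    case (step y z)
    then have yz: "{y, z} \<in> T" "{z, y} \<in> T"
      by (auto simp: edge_rel_def insert_commute)
    have "(e, {y, z}) \<in> (exchange_rel P T)\<^sup>*"
      using step.IH yz(1) by blast
    then have "(e, {z, y}) \<in> (exchange_rel P T)\<^sup>*"
      by (simp add: insert_commute[of z y])
    then show ?case
      using exchange_rel_at_vertex[OF fin gp T yz(2)] by (meson rtrancl_trans)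
  qed
  moreover have "joined T u x"
    using tree uv(2) xy(2) by (simp add: bridge_tree_def)
  ultimately show ?thesis
    using e' xy(1) by blast
qed

section \<open>Existence of an exchange and conclusion\<close>

lemma tree_edge_at:
  assumes "bridge_tree P T" "u \<in> P" "v \<in> P" "u \<noteq> v"
  obtains w where "{u, w} \<in> T"
proof -
  have "joined T u v"
    using assms by (simp add: bridge_tree_def)
  then show thesis
    using assms(4) that by (auto simp: edge_rel_def elim: converse_rtranclE)
qed

theorem theorem3:
  fixes P :: "(real ^ 2) set" and T :: "(real ^ 2) set set"
  assumes "finite P" and "general_position P" and "card P \<ge> 5"
    and "T \<in> pverts (SST_graph P)"
  shows "Digraph_Component.connected (with_proj (clique_graph P T))"
proof -
  have T: "is_SST P T"
    using assms(4) by (simp add: SST_graph_simps)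
  note rel = exchange_rel_connected[OF assms(1,2) T]
  have tree: "bridge_tree P T"
    using T by (rule is_SST_bridge_tree)
  have ex: "\<exists>z\<in>P. z \<notin> A" if "finite A" "card A \<le> 2" for A
    using card_mono[OF that(1), of P] that(2) assms(3) by (auto simp: subset_iff)
  obtain u where u: "u \<in> P"
    using ex[of "{}"] by auto
  obtain v where "v \<in> P" "v \<noteq> u"
    using ex[of "{u}"] by auto
  then obtain w where w: "{u, w} \<in> T"
    using tree_edge_at[OF tree u] by metis
  obtain z where z: "z \<in> P" "z \<notin> {u, w}"
    using ex[of "{u, w}"] card_insert_le_m1[of 2 "{w}" u] by auto
  then obtain y where y: "{z, y} \<in> T"
    using tree_edge_at[OF tree z(1) u] by auto
  \<comment> \<open>A chain between distinct edges has a first step, which supplies an exchange and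
    hence a vertex of the clique graph.\<close>
  have "{u, w} \<noteq> {z, y}"
    using z by auto
  then obtain e where "({u, w}, e) \<in> exchange_rel P T"
    using rel[OF w y] by (meson converse_rtranclE)
  then obtain f where "exchange P T {u, w} f"
    by (auto simp: exchange_rel_def)
  then show ?thesis
    using connected_clique_graph[OF T _ rel] by blast
qed

end
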